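(* Let $k$ and $n$ be positive integers and let $P$ be a $(kn,n)$-Dyck path. Let $\sigma=(\sigma_1,\dots,\sigma_{kn+n})$ be the output sequence of the sweep map applied from right to left to $P$, and $\tau=(\tau_1,\dots,\tau_{kn+n})$ the corresponding sequence of levels. If $\sigma_i=\mathrm{W}$ has level $\tau_i=mn$ and $\sigma_{i+1}=\mathrm{S}$, then $\tau_{i+1}=mn$ as well. Moreover, if in addition $\sigma_{i+2}=\mathrm{S}$, then $\tau_{i+2}=mn$ also.
   Context: A $(kn,n)$-Dyck path is a lattice path from $(0,0)$ to $(kn,n)$ consisting of $kn$ unit east steps and $n$ unit north steps that never passes below the line $y=x/k$. The level of a lattice point $(x,y)$ is $kn\cdot y-n\cdot x$; thus the path stays at levels $\ge 0$, a north step raises the level by $kn$ and an east step lowers it by $n$. Each step is recorded by its starting point: a north step is recorded as S (its south endpoint) and an east step as W (its west endpoint); the level of a step is the level of its starting point. The sweep map applied from right to left lists all $kn+n$ steps in order of nondecreasing level, where among steps of equal level the one occurring later along the path (further to the right) is listed first. The output sequence $\sigma$ is the resulting word in the letters S and W, and $\tau_j$ is the level of the step listed in position $j$ (so $\tau$ is nondecreasing). *)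

theory Defs
  imports Complex_Main
begin

datatype step = North | East

datatype letter = S | W

fun letter_of :: "step \<Rightarrow> letter" where
  "letter_of North = S"
| "letter_of East = W"

text \<open>\<open>vertex P j\<close> is the lattice point reached after the first \<open>j\<close> steps, that is, the
  starting point of the step \<open>P ! j\<close>.\<close>

definition vertex :: "step list \<Rightarrow> nat \<Rightarrow> nat \<times> nat" where
  "vertex P j = (count_list (take j P) East, count_list (take j P) North)"

definition dyck_path :: "nat \<Rightarrow> nat \<Rightarrow> step list \<Rightarrow> bool" where
  "dyck_path k n P \<longleftrightarrow>
     count_list P East = k * n \<and> count_list P North = n \<and>
     (\<forall>j\<le>length P. case vertex P j of (x, y) \<Rightarrow> real y \<ge> real x / real k)"

definition level :: "nat \<Rightarrow> nat \<Rightarrow> nat \<times> nat \<Rightarrow> int" where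
  "level k n = (\<lambda>(x, y). int (k * n) * int y - int n * int x)"

definition step_level :: "nat \<Rightarrow> nat \<Rightarrow> step list \<Rightarrow> nat \<Rightarrow> int" where
  "step_level k n P j = level k n (vertex P j)"

text \<open>\<open>sort_key\<close> is stable, so starting from the decreasing list of positions puts, among
  steps of equal level, the one occurring later along the path first.\<close>

definition sweep_order :: "nat \<Rightarrow> nat \<Rightarrow> step list \<Rightarrow> nat list" where
  "sweep_order k n P = sort_key (step_level k n P) (rev [0..<length P])"

definition sweep_word :: "nat \<Rightarrow> nat \<Rightarrow> step list \<Rightarrow> letter list" where
  "sweep_word k n P = map (\<lambda>j. letter_of (P ! j)) (sweep_order k n P)"

definition sweep_levels :: "nat \<Rightarrow> nat \<Rightarrow> step list \<Rightarrow> int list" where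
  "sweep_levels k n P = map (step_level k n P) (sweep_order k n P)"

end

theory Submission
  imports Defs
begin

text \<open>Dividing levels by \<open>n\<close>, a north step goes up by \<open>k\<close> and an east step goes down by exactly
  \<open>1\<close>. So after a north step from a positive height the path, which ends at height \<open>0\<close>, must come
  back to that height: at every positive level the rightmost step is an east step. Whenever the
  level jumps up in the sweep order, the first step listed at the new level is the rightmost one
  there, hence a \<open>W\<close>; an \<open>S\<close> following a listed step therefore has the same level.\<close>

text \<open>A discrete intermediate value principle: a drop of at most 1 per step cannot skip an
  integer. Only drops are bounded, so upward jumps of any size are allowed.\<close>

lemma descending_hits_value:
  fixes h :: "nat \<Rightarrow> int"
  assumes "a \<le> b" and "\<And>q. a \<le> q \<Longrightarrow> q < b \<Longrightarrow> h q - 1 \<le> h (Suc q)"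
    and "v \<le> h a" and "h b < v"
  shows "\<exists>q. a \<le> q \<and> q < b \<and> h q = v"
  using assms
proof (induction b rule: dec_induct)
  case base
  then show ?case by simp
next
  case (step b)
  show ?case
  proof (cases "h b < v")
    case True
    then have "\<exists>q. a \<le> q \<and> q < b \<and> h q = v"
      using step.IH step.prems by simp
    then show ?thesis by auto
  next
    \<comment> \<open>This is the crossing step: \<open>h b\<close> is at least \<open>v\<close> and
      \<open>h (Suc b)\<close> is below it, and a drop of at most 1 forces
      \<open>h b = v\<close>.\<close>
    case False
    have "h b - 1 \<le> h (Suc b)"
      using step.prems(1)[of b] step.hyps by simp
    with False step.prems(3) have "h b = v" by simp
    with step.hyps show ?thesis by auto
  qed
qed

definition height :: "nat \<Rightarrow> step list \<Rightarrow> nat \<Rightarrow> int" where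
  "height k P j = int k * int (count_list (take j P) North) - int (count_list (take j P) East)"

lemma step_level_eq_height: "step_level k n P j = int n * height k P j"
  by (simp add: step_level_def level_def vertex_def height_def algebra_simps)

lemma height_Suc:
  assumes "j < length P"
  shows "height k P (Suc j) = (if P ! j = North then height k P j + int k else height k P j - 1)"
  using assms by (cases "P ! j") (auto simp: height_def take_Suc_conv_app_nth algebra_simps)

lemma length_dyck_path:
  assumes "dyck_path k n P"
  shows "length P = k * n + n"
proof -
  have "length xs = count_list xs East + count_list xs North" for xs
  proof (induction xs)
    case (Cons s xs)
    then show ?case by (cases s) auto
  qed simp
  with assms show ?thesis by (simp add: dyck_path_def)
qed

lemma height_nonneg:
  assumes "dyck_path k n P" and "k > 0" and "j \<le> length P"
  shows "0 \<le> height k P j"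
proof -
  let ?x = "count_list (take j P) East" and ?y = "count_list (take j P) North"
  have "real ?x / real k \<le> real ?y"
    using assms by (auto simp: dyck_path_def vertex_def)
  with \<open>k > 0\<close> have "real ?x \<le> real (k * ?y)"
    by (simp add: field_simps)
  then have "int ?x \<le> int (k * ?y)"
    by linarith
  then show ?thesis by (simp add: height_def)
qed

lemma north_step_level_recurs:
  assumes "dyck_path k n P" and "j < length P" and "P ! j = North" and "0 < height k P j"
  shows "\<exists>q>j. q < length P \<and> height k P q = height k P j"
proof -
  have "height k P (length P) = 0"
    using assms(1) by (simp add: height_def dyck_path_def)
  moreover have "height k P j \<le> height k P (Suc j)"
    using assms(2,3) by (simp add: height_Suc)
  \<comment> \<open>Starting the descent at \<open>Suc j\<close> makes the hit strictly later than
    \<open>j\<close>. It also lies before the endpoint, so \<open>q\<close> is the position of an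
    actual step.\<close>
  ultimately have "\<exists>q. Suc j \<le> q \<and> q < length P \<and> height k P q = height k P j"
    using assms(2,4) by (intro descending_hits_value) (auto simp: height_Suc)
  then show ?thesis by (auto simp: Suc_le_eq)
qed

text \<open>A strict increase of the key at \<open>Suc i\<close> means that the block of equal keys
  begins there, and stability keeps each block in the decreasing order of the input list.\<close>

lemma sort_key_rev_upt_first_is_greatest:
  fixes f :: "nat \<Rightarrow> 'a::linorder" and N :: nat
  defines "xs \<equiv> sort_key f (rev [0..<N])"
  assumes "Suc i < N" and "f (xs ! i) < f (xs ! Suc i)"
    and "j < N" and "f j = f (xs ! Suc i)"
  shows "j \<le> xs ! Suc i"
proof -
  have len: "length xs = N" by (simp add: xs_def)
  have sorted: "sorted (map f xs)" by (simp add: xs_def)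
  define pre post where "pre = take (Suc i) xs" and "post = drop (Suc (Suc i)) xs"
  have split: "xs = pre @ xs ! Suc i # post"
    using assms(2) len by (simp add: pre_def post_def id_take_nth_drop)
  have "j \<in> set xs" using assms(4) by (simp add: xs_def)
  \<comment> \<open>Entries of \<open>pre\<close> have key at most \<open>f (xs ! i)\<close>, which
    is smaller than \<open>f j\<close>.\<close>
  moreover have "j \<notin> set pre"
  proof
    assume "j \<in> set pre"
    then obtain q where "q \<le> i" "j = xs ! q"
      using assms(2) len by (auto simp: pre_def in_set_conv_nth less_Suc_eq_le)
    then have "f j \<le> f (xs ! i)"
      using sorted_nth_mono[OF sorted, of q i] assms(2) len by simp
    with assms(3,5) show False by simp
  qed
  ultimately have "j = xs ! Suc i \<or> j \<in> set post"
    using split by (metis Un_iff insert_iff list.set(2) set_append)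
  moreover have "j < xs ! Suc i" if "j \<in> set post"
  proof -
    \<comment> \<open>Restricted to one key, the sorted list equals the restricted input and is thus
      strictly decreasing; \<open>xs ! Suc i\<close> precedes all of \<open>post\<close> in
      it.\<close>
    let ?same = "\<lambda>y. f y = f (xs ! Suc i)"
    have "filter ?same xs = filter ?same (rev [0..<N])"
      unfolding xs_def by (rule sort_key_stable)
    then have "sorted_wrt (>) (filter ?same xs)"
      by (simp add: sorted_wrt_filter sorted_wrt_rev)
    moreover have "filter ?same xs = filter ?same pre @ xs ! Suc i # filter ?same post"
      by (subst split) simp
    ultimately show ?thesis
      using that assms(5) by (simp add: sorted_wrt_append)
  qed
  ultimately show ?thesis by auto
qed

lemma sweep_word_W_at_level_increase:
  assumes "dyck_path k n P" and "k > 0" and "Suc i < length P"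
    and "sweep_levels k n P ! i < sweep_levels k n P ! Suc i"
  shows "sweep_word k n P ! Suc i = W"
proof -
  let ?f = "step_level k n P" and ?xs = "sweep_order k n P"
  have len: "length ?xs = length P" by (simp add: sweep_order_def)
  have set: "set ?xs = {0..<length P}" by (simp add: sweep_order_def)
  have in_range: "?xs ! q < length P" if "q < length P" for q
    using nth_mem[of q ?xs] that len set by simp
  have less: "?f (?xs ! i) < ?f (?xs ! Suc i)"
    using assms(3,4) len by (simp add: sweep_levels_def)
  \<comment> \<open>The Dyck condition enters here: a jump from a nonnegative level lands on a
    positive one. Level 0 must be excluded, since all steps starting there are north steps.\<close>
  have "0 \<le> ?f (?xs ! i)"
    using height_nonneg[OF assms(1,2), of "?xs ! i"] in_range[of i] assms(3)
    by (simp add: step_level_eq_height)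
  with less have "0 < ?f (?xs ! Suc i)" by linarith
  then have pos: "0 < height k P (?xs ! Suc i)"
    by (auto simp: step_level_eq_height zero_less_mult_iff)
  have "P ! (?xs ! Suc i) \<noteq> North"
  proof
    assume "P ! (?xs ! Suc i) = North"
    then obtain q where q: "?xs ! Suc i < q" "q < length P" "?f q = ?f (?xs ! Suc i)"
      using north_step_level_recurs[OF assms(1) in_range[OF assms(3)] _ pos]
      by (auto simp: step_level_eq_height)
    then have "q \<le> ?xs ! Suc i"
      using sort_key_rev_upt_first_is_greatest[OF assms(3), of ?f q] less
      by (simp add: sweep_order_def)
    with q show False by simp
  qed
  then have "P ! (?xs ! Suc i) = East" by (cases "P ! (?xs ! Suc i)") auto
  then show ?thesis using assms(3) len by (simp add: sweep_word_def)
qed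

text \<open>Sortedness leaves only equality or a strict increase, and a strict increase would list a
  \<open>W\<close>.\<close>

lemma sweep_S_same_level_as_previous:
  assumes "dyck_path k n P" and "k > 0" and "Suc i < length P"
    and "sweep_word k n P ! Suc i = S"
  shows "sweep_levels k n P ! Suc i = sweep_levels k n P ! i"
proof -
  have "sorted (sweep_levels k n P)" and "length (sweep_levels k n P) = length P"
    by (simp_all add: sweep_levels_def sweep_order_def)
  with assms(3) have "sweep_levels k n P ! i \<le> sweep_levels k n P ! Suc i"
    by (simp add: sorted_nth_mono)
  moreover have "\<not> sweep_levels k n P ! i < sweep_levels k n P ! Suc i"
    using sweep_word_W_at_level_increase[OF assms(1-3)] assms(4) by auto
  ultimately show ?thesis by simp
qed

theorem theorem2p1:
  fixes k n i :: nat and m :: int and P :: "step list"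
    and \<sigma> :: "letter list" and \<tau> :: "int list"
  assumes "k > 0" and "n > 0"
    and "dyck_path k n P"
    and "\<sigma> = sweep_word k n P" and "\<tau> = sweep_levels k n P"
    and "i + 1 < k * n + n"
    and "\<sigma> ! i = W" and "\<tau> ! i = m * int n"
    and "\<sigma> ! (i + 1) = S"
  shows "\<tau> ! (i + 1) = m * int n \<and>
    (i + 2 < k * n + n \<and> \<sigma> ! (i + 2) = S \<longrightarrow> \<tau> ! (i + 2) = m * int n)"
proof -
  have same: "\<tau> ! Suc q = \<tau> ! q" if "Suc q < k * n + n" "\<sigma> ! Suc q = S" for q
    using sweep_S_same_level_as_previous[OF assms(3,1)] that length_dyck_path[OF assms(3)] assms(4,5)
    by simp
  show ?thesis
    \<comment> \<open>The level is carried from \<open>i\<close> to \<open>i + 1\<close>, and then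
      from \<open>i + 1\<close> to \<open>i + 2\<close>.\<close>
    using same[of i] same[of "Suc i"] assms(6,8,9) by auto
qed

end
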